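(* Let $X$ be a càdlàg process such that $\mathbb{P}[\Delta X_t\neq 0]=0$ for every $t$. Let $(\pi^n=\{t^n_1<\ldots<t^n_{k^n}\})_n$ be an increasing sequence of subdivisions of $[0,T]$ with mesh $|\pi^n|\to 0$ as $n\to+\infty$. Define the discretized processes $X^n$ by $$X^n_t=\sum_{i=1}^{k^n-1}X_{t^n_i}1_{\{t^n_i\leqslant t<t^n_{i+1}\}}\quad\text{for } t<T,\qquad X^n_T=X_T.$$ Then $\Gamma_n(L)\to\Gamma(L)$ as $n\to+\infty$.
   Context: $(\Omega,\mathcal{A},\mathbb{P})$ is a fixed probability space, $T>0$ is fixed and $L\in[0,T]$ is fixed. All processes are real-valued and indexed by $[0,T]$; all filtrations are indexed by $[0,T]$. A subdivision of $[0,T]$ is a finite set $0=t_1<\ldots<t_k=T$, with mesh $\max_i(t_{i+1}-t_i)$; the sequence is increasing in the sense $\pi^n\subset\pi^{n+1}$. $\gamma:[0,+\infty[\times\mathbb{R}\to\mathbb{R}$ is a fixed bounded continuous function. $\mathcal{F}^X$ is the natural filtration of $X$, $\mathcal{F}_t=\mathcal{F}^X_{t+}$ is the associated right-continuous filtration, and $\mathcal{F}^n$ is the natural filtration of $X^n$. The values in optimal stopping are $\Gamma(L)=\sup\mathbb{E}[\gamma(\tau,X_\tau)]$ over $\mathcal{F}$-stopping times $\tau$ bounded by $L$, and $\Gamma_n(L)=\sup\mathbb{E}[\gamma(\tau,X^n_\tau)]$ over $\mathcal{F}^n$-stopping times $\tau$ bounded by $L$. *)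

theory Defs
  imports "HOL-Probability.Probability"
begin

definition cadlag :: "real \<Rightarrow> (real \<Rightarrow> real) \<Rightarrow> bool" where
  "cadlag T f \<longleftrightarrow>
     (\<forall>t\<in>{0..<T}. (f \<longlongrightarrow> f t) (at_right t)) \<and>
     (\<forall>t\<in>{0<..T}. \<exists>l. (f \<longlongrightarrow> l) (at_left t))"

(* All paths (not just almost all) are cadlag. *)
definition cadlag_process :: "'a measure \<Rightarrow> real \<Rightarrow> (real \<Rightarrow> 'a \<Rightarrow> real) \<Rightarrow> bool" where
  "cadlag_process M T X \<longleftrightarrow>
     (\<forall>t\<in>{0..T}. X t \<in> borel_measurable M) \<and>
     (\<forall>\<omega>\<in>space M. cadlag T (\<lambda>t. X t \<omega>))"

(* At time 0 the usual convention X_{0-} = X_0 applies. *)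
definition jump :: "(real \<Rightarrow> 'a \<Rightarrow> real) \<Rightarrow> real \<Rightarrow> 'a \<Rightarrow> real" where
  "jump X t \<omega> = (if t = 0 then 0 else X t \<omega> - Lim (at_left t) (\<lambda>s. X s \<omega>))"

definition subdivision :: "real \<Rightarrow> real set \<Rightarrow> bool" where
  "subdivision T p \<longleftrightarrow> finite p \<and> p \<subseteq> {0..T} \<and> 0 \<in> p \<and> T \<in> p"

(* List indices start at 0: the point t_i is sorted_list_of_set p ! (i - 1). *)
definition mesh :: "real set \<Rightarrow> real" where
  "mesh p = (let ts = sorted_list_of_set p in
     Max ((\<lambda>i. ts ! Suc i - ts ! i) ` {..<length ts - 1}))"

definition discretization ::
  "real \<Rightarrow> real set \<Rightarrow> (real \<Rightarrow> 'a \<Rightarrow> real) \<Rightarrow> real \<Rightarrow> 'a \<Rightarrow> real" where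
  "discretization T p X t \<omega> =
     (if t < T then
        let ts = sorted_list_of_set p in
          \<Sum>i<length ts - 1. X (ts ! i) \<omega> * indicator {ts ! i..<ts ! Suc i} t
      else X T \<omega>)"

(* Filtrations on [0,T] are extended to all real indices, constantly after T. No null sets
   are added. *)
definition natural_filtration ::
  "'a measure \<Rightarrow> real \<Rightarrow> (real \<Rightarrow> 'a \<Rightarrow> real) \<Rightarrow> real \<Rightarrow> 'a measure" where
  "natural_filtration M T X t =
     sigma (space M) {X s -` A \<inter> space M |s A. s \<in> {0..min t T} \<and> A \<in> sets borel}"

(* The intersection is already a sigma-algebra; sigma only turns it into a measure space.
   Because of the constant extension, F_{T+} = F_T for filtrations on [0,T]. *)
definition right_limit_filtration :: "(real \<Rightarrow> 'a measure) \<Rightarrow> real \<Rightarrow> 'a measure" where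
  "right_limit_filtration F t = sigma (space (F t)) (\<Inter>s\<in>{t<..}. sets (F s))"

(* For tau with values in [0,L], where L \<le> T, the condition in stopping_time is void at
   times outside [0,T]. The supremum is over a nonempty set, bounded when g is bounded. *)
definition stopping_value ::
  "'a measure \<Rightarrow> (real \<times> real \<Rightarrow> real) \<Rightarrow> (real \<Rightarrow> 'a measure) \<Rightarrow>
    (real \<Rightarrow> 'a \<Rightarrow> real) \<Rightarrow> real \<Rightarrow> real" where
  "stopping_value M g F X L =
     (SUP \<tau>\<in>{\<tau>. stopping_time F \<tau> \<and> (\<forall>\<omega>\<in>space M. \<tau> \<omega> \<in> {0..L})}.
        \<integral>\<omega>. g (\<tau> \<omega>, X (\<tau> \<omega>) \<omega>) \<partial>M)"

end

theory Submission
  imports Defs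
begin

text \<open>
  The convergence splits into two one-sided bounds, and both are obtained by moving stopping
  times to partition points.

  \<^bold>\<open>Upper bound.\<close> On a cell $[a,b)$ of the $n$-th subdivision the
  discretised process is frozen at $X_a$, and so is its filtration. Hence rounding a stopping
  time $\tau$ of the discretised filtration \<^emph>\<open>down\<close> to the last partition
  point $\sigma \le \tau$ gives another stopping time of the same filtration: $\{\sigma \le t\}
  = \{\tau < b\}$ for $t$ in $[a,b)$, and this event is decided by the observations up to $a$
  (\<open>last_point_stopping_time\<close>). The discretised process at $\tau$ is $X_\sigma$, so
  the only loss is that the reward reads the clock at $\tau$ rather than at $\sigma$. Paths are
  bounded, so the reward is uniformly continuous along them and this loss vanishes with the mesh
  (\<open>rounding_error_vanishes\<close>). As $\sigma$ is also a stopping time for the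
  filtration of $X$, its payoff is at most the limiting value.

  \<^bold>\<open>Lower bound.\<close> A stopping time $\tau$ of the right-continuous filtration
  is rounded \<^emph>\<open>up\<close>, strictly, to the points of one fixed subdivision, with
  $L$ in place of the points beyond $L$. Right-continuity of the paths makes the payoff of the
  rounded time converge (\<open>round_up_payoff_converges\<close>). The rounded time is
  determined by finitely many events $\{\tau < r\}$ with $r$ a partition point, and these belong
  to the natural filtration of $X$ at time $r$, without any right limit. Because $r$ is itself a
  partition point and the partition points are dense, that sigma-algebra is generated by the
  increasing union of the discretised ones (\<open>\<F>\<^sub>X_le_sigma_\<F>\<^sub>D\<close>),
  so each event can be replaced by one of a discretised filtration up to small probability
  (\<open>approximation_by_increasing_union\<close>). No event is needed at the terminal point
  $L$, which need not be a partition point: stopping there is what remains. This yields one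
  fixed, finitely valued time that is a stopping time for all later discretised filtrations, and
  its payoffs converge because, in the absence of fixed jumps, $X^n_r \to X_r$ almost surely at
  each fixed $r$ (\<open>fixed_time_convergence\<close>).
\<close>

section \<open>Subdivisions and discretised paths\<close>

text \<open>
  The largest point of $p$ not exceeding $t$. Inserting $0$, which belongs to every subdivision
  of $[0,T]$, keeps the maximum defined for negative $t$.
\<close>

definition last_point :: "real set \<Rightarrow> real \<Rightarrow> real" where
  "last_point p t = Max (insert 0 {s \<in> p. s \<le> t})"

lemma last_point_eqI:
  assumes "a \<in> p" "0 \<le> a" "a \<le> t" "\<And>s. s \<in> p \<Longrightarrow> s \<le> t \<Longrightarrow> s \<le> a" "finite p"
  shows "last_point p t = a"
  unfolding last_point_def using assms by (intro Max_eqI) auto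

text \<open>
  Locating $t$ in the sorted list of partition points connects the list-based
  \<open>mesh\<close> and \<open>discretization\<close> with the order on the set of points, on
  which everything below relies.
\<close>

lemma subdivision_cell:
  assumes p: "subdivision T p" and t: "t \<in> {0..<T}"
  defines "ts \<equiv> sorted_list_of_set p"
  obtains i where "i < length ts - 1" "ts ! i \<le> t" "t < ts ! Suc i"
    "\<And>s. s \<in> p \<Longrightarrow> s \<le> ts ! i \<or> ts ! Suc i \<le> s"
    "ts ! i \<in> p" "ts ! Suc i \<in> p" "ts ! Suc i - ts ! i \<le> mesh p"
proof -
  have set: "set ts = p" and srt: "sorted ts"
    using p by (auto simp: ts_def subdivision_def)
  have p': "p \<subseteq> {0..T}" "0 \<in> p" "T \<in> p"
    using p by (auto simp: subdivision_def)
  obtain k where k: "k < length ts" "ts ! k = T"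
    using p' set by (metis in_set_conv_nth)
  define j where "j = (LEAST j. j < length ts \<and> t < ts ! j)"
  have j: "j < length ts" "t < ts ! j"
    using LeastI[of "\<lambda>j. j < length ts \<and> t < ts ! j" k] k t by (auto simp: j_def)
  have below: "ts ! i \<le> t" if "i < j" for i
    using not_less_Least[of i "\<lambda>j. j < length ts \<and> t < ts ! j"] that j(1)
    by (auto simp: j_def)
  obtain z where z: "z < length ts" "ts ! z = 0"
    using p' set by (metis in_set_conv_nth)
  have "j \<noteq> 0"
  proof
    assume "j = 0"
    then have "ts ! j \<le> ts ! z"
      using srt z by (intro sorted_nth_mono) auto
    then show False using j(2) z(2) t by auto
  qed
  then obtain i where i: "j = Suc i" by (cases j) auto
  show ?thesis
  proof
    show "i < length ts - 1" "ts ! i \<le> t" "t < ts ! Suc i" "ts ! i \<in> p" "ts ! Suc i \<in> p"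
      using i j below[of i] set by auto
    show "s \<le> ts ! i \<or> ts ! Suc i \<le> s" if sp: "s \<in> p" for s
    proof -
      obtain l where l: "l < length ts" "ts ! l = s"
        using sp set by (metis in_set_conv_nth)
      show ?thesis
      proof (cases "l \<le> i")
        case True
        then have "ts ! l \<le> ts ! i" using i j(1) by (intro sorted_nth_mono[OF srt]) auto
        then show ?thesis using l by simp
      next
        case False
        then have "ts ! Suc i \<le> ts ! l" using l by (intro sorted_nth_mono[OF srt]) auto
        then show ?thesis using l by simp
      qed
    qed
    show "ts ! Suc i - ts ! i \<le> mesh p"
      unfolding mesh_def Let_def ts_def[symmetric]
      using i j(1) by (intro Max_ge) auto
  qed
qed

text \<open>
  The point $b$ is the right end of the cell containing $t$. That rounding down ends at or
  before $t$ exactly for the times before $b$ is what makes it compatible with the filtration of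
  the discretised process.
\<close>

lemma last_point_cell:
  assumes p: "subdivision T p" and t: "t \<in> {0..<T}"
  obtains b where "b \<in> p" "t < b" "b - last_point p t \<le> mesh p"
    "last_point p t \<le> t" "\<And>s. s \<in> {0..T} \<Longrightarrow> last_point p s \<le> t \<longleftrightarrow> s < b"
    "\<And>s. s \<in> p \<Longrightarrow> s < b \<Longrightarrow> s \<le> t"
proof -
  obtain i where i: "sorted_list_of_set p ! i \<le> t" "t < sorted_list_of_set p ! Suc i"
    "\<And>s. s \<in> p \<Longrightarrow> s \<le> sorted_list_of_set p ! i \<or> sorted_list_of_set p ! Suc i \<le> s"
    "sorted_list_of_set p ! i \<in> p" "sorted_list_of_set p ! Suc i \<in> p"
    "sorted_list_of_set p ! Suc i - sorted_list_of_set p ! i \<le> mesh p"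
    using subdivision_cell[OF p t] by metis
  have p': "finite p" "p \<subseteq> {0..T}"
    using p by (auto simp: subdivision_def)
  have a: "last_point p t = sorted_list_of_set p ! i"
    using i p' by (intro last_point_eqI) force+
  show ?thesis
  proof (rule that[of "sorted_list_of_set p ! Suc i"])
    show "last_point p s \<le> t \<longleftrightarrow> s < sorted_list_of_set p ! Suc i" if "s \<in> {0..T}" for s
      using i p' that t unfolding last_point_def by (subst Max_le_iff) force+
    show "s \<le> t" if "s \<in> p" "s < sorted_list_of_set p ! Suc i" for s
      using i(3)[OF that(1)] that(2) i(1) by linarith
  qed (use i a in simp_all)
qed

lemma last_point_end:
  assumes "subdivision T p" shows "last_point p T = T"
  using assms by (intro last_point_eqI) (auto simp: subdivision_def)

text \<open>
  In the defining sum only the cell that contains $t$ contributes; at $t = T$ the last partition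
  point is $T$ itself.
\<close>

lemma discretization_eq_last_point:
  assumes p: "subdivision T p" and t: "t \<in> {0..T}"
  shows "discretization T p X t \<omega> = X (last_point p t) \<omega>"
proof (cases "t < T")
  case False
  then show ?thesis
    using t last_point_end[OF p] by (simp add: discretization_def)
next
  case True
  define ts where "ts = sorted_list_of_set p"
  have t': "t \<in> {0..<T}" using True t by auto
  have p': "finite p" "p \<subseteq> {0..T}"
    using p by (auto simp: subdivision_def)
  obtain i where i: "i < length ts - 1" "ts ! i \<le> t" "t < ts ! Suc i"
    "\<And>s. s \<in> p \<Longrightarrow> s \<le> ts ! i \<or> ts ! Suc i \<le> s" "ts ! i \<in> p"
    using subdivision_cell[OF p t'] unfolding ts_def by metis
  have srt: "sorted ts" by (simp add: ts_def)
  have a: "last_point p t = ts ! i"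
    using i p' by (intro last_point_eqI) force+
  have "X (ts ! k) \<omega> * indicator {ts ! k..<ts ! Suc k} t = (if k = i then X (ts ! i) \<omega> else 0)"
    if k: "k < length ts - 1" for k
  proof -
    have "ts ! Suc k \<le> ts ! i" if "k < i"
      using that srt i(1) by (intro sorted_nth_mono) auto
    moreover have "ts ! Suc i \<le> ts ! k" if "k > i"
      using that srt k by (intro sorted_nth_mono) auto
    ultimately show ?thesis
      using i by (cases k i rule: linorder_cases) (auto simp: indicator_def)
  qed
  then have "(\<Sum>k<length ts - 1. X (ts ! k) \<omega> * indicator {ts ! k..<ts ! Suc k} t)
      = (\<Sum>k<length ts - 1. if k = i then X (ts ! i) \<omega> else 0)"
    by (intro sum.cong) auto
  then show ?thesis
    using True i(1) a by (simp add: discretization_def ts_def[symmetric])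
qed

lemma last_point_le:
  assumes "subdivision T p" "t \<in> {0..T}"
  shows "last_point p t \<le> t" "last_point p t \<in> p"
proof -
  have fin: "finite p" "0 \<in> p" using assms by (auto simp: subdivision_def)
  then show "last_point p t \<le> t" using assms by (auto simp: last_point_def)
  have "last_point p t \<in> insert 0 {s \<in> p. s \<le> t}"
    unfolding last_point_def by (rule Max_in) (use fin in auto)
  then show "last_point p t \<in> p" using fin by auto
qed

lemma mesh_nonneg:
  assumes "subdivision T p" "T > 0" shows "0 \<le> mesh p"
proof -
  have "0 \<in> {0..<T}" using assms(2) by simp
  then obtain b where "0 < b" "b - last_point p 0 \<le> mesh p" "last_point p 0 \<le> 0"
    by (rule last_point_cell[OF assms(1)])
  then show ?thesis by linarith
qed

lemma last_point_close:
  assumes "subdivision T p" "T > 0" "t \<in> {0..T}"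
  shows "t - mesh p \<le> last_point p t"
proof (cases "t < T")
  case True
  then have "t \<in> {0..<T}" using assms by auto
  then obtain b where "t < b" "b - last_point p t \<le> mesh p"
    by (rule last_point_cell[OF assms(1)])
  then show ?thesis by linarith
next
  case False
  then show ?thesis using assms last_point_end[OF assms(1)] mesh_nonneg[OF assms(1,2)] by auto
qed

lemma subdivision_fixed_point:
  assumes "subdivision T p" "r \<in> p"
  shows "last_point p r = r"
  using assms by (intro last_point_eqI) (auto simp: subdivision_def)

lemma next_point:
  assumes p: "subdivision T p" and t: "0 \<le> t" "t < r" and r: "r \<in> p"
  obtains d where "d \<in> p" "t < d" "d \<le> r" "d \<le> t + mesh p"
proof -
  have t': "t \<in> {0..<T}" using p t r by (auto simp: subdivision_def)
  obtain b where b: "b \<in> p" "t < b" "b - last_point p t \<le> mesh p" "last_point p t \<le> t"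
    "\<And>s. s \<in> p \<Longrightarrow> s < b \<Longrightarrow> s \<le> t"
    using last_point_cell[OF p t'] by metis
  show ?thesis
  proof (rule that[of b])
    show "b \<le> r" using b(5)[OF r] t(2) by linarith
  qed (use b in auto)
qed

section \<open>Cadlag paths\<close>

text \<open>
  One-sided limits make the path bounded near every point of $[0,T]$ apart from the point
  itself, and compactness gives a finite cover by such neighbourhoods.
\<close>

lemma cadlag_bounded:
  assumes f: "cadlag T f"
  obtains B where "\<And>t. t \<in> {0..T} \<Longrightarrow> \<bar>f t\<bar> \<le> B"
proof -
  have "\<exists>U B. open U \<and> t \<in> U \<and> (\<forall>s\<in>U \<inter> {0..T}. \<bar>f s\<bar> \<le> B)" if t: "t \<in> {0..T}" for t
  proof -
    have R: "\<exists>b>t. \<exists>B. \<forall>s\<in>{t<..<b}. s \<le> T \<longrightarrow> \<bar>f s\<bar> \<le> B"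
    proof (cases "t < T")
      case True
      then have "(f \<longlongrightarrow> f t) (at_right t)" using f t by (auto simp: cadlag_def)
      then have "\<forall>\<^sub>F s in at_right t. dist (f s) (f t) < 1" by (rule tendstoD) simp
      then obtain b where b: "b > t" "\<And>s. s > t \<Longrightarrow> s < b \<Longrightarrow> dist (f s) (f t) < 1"
        unfolding eventually_at_right_field by auto
      have "\<forall>s\<in>{t<..<b}. s \<le> T \<longrightarrow> \<bar>f s\<bar> \<le> \<bar>f t\<bar> + 1"
        using b(2) by (force simp: dist_real_def)
      with b(1) show ?thesis by blast
    next
      case False
      then have "\<forall>s\<in>{t<..<t+1}. s \<le> T \<longrightarrow> \<bar>f s\<bar> \<le> 0" using t by auto
      then show ?thesis by (intro exI[of _ "t+1"]) auto
    qed
    have Lf: "\<exists>a<t. \<exists>B. \<forall>s\<in>{a<..<t}. 0 \<le> s \<longrightarrow> \<bar>f s\<bar> \<le> B"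
    proof (cases "0 < t")
      case True
      then have "t \<in> {0<..T}" using t by auto
      then obtain l where "(f \<longlongrightarrow> l) (at_left t)" using f unfolding cadlag_def by blast
      then have "\<forall>\<^sub>F s in at_left t. dist (f s) l < 1" by (rule tendstoD) simp
      then obtain a where a: "a < t" "\<And>s. s > a \<Longrightarrow> s < t \<Longrightarrow> dist (f s) l < 1"
        unfolding eventually_at_left_field by auto
      have "\<forall>s\<in>{a<..<t}. 0 \<le> s \<longrightarrow> \<bar>f s\<bar> \<le> \<bar>l\<bar> + 1"
        using a(2) by (force simp: dist_real_def)
      with a(1) show ?thesis by blast
    next
      case False
      then have "\<forall>s\<in>{t-1<..<t}. 0 \<le> s \<longrightarrow> \<bar>f s\<bar> \<le> 0" using t by auto
      then show ?thesis by (intro exI[of _ "t-1"]) auto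
    qed
    obtain b B1 where b: "b > t" "\<And>s. s \<in> {t<..<b} \<Longrightarrow> s \<le> T \<Longrightarrow> \<bar>f s\<bar> \<le> B1"
      using R by blast
    obtain a B2 where a: "a < t" "\<And>s. s \<in> {a<..<t} \<Longrightarrow> 0 \<le> s \<Longrightarrow> \<bar>f s\<bar> \<le> B2"
      using Lf by blast
    have "\<bar>f s\<bar> \<le> max \<bar>f t\<bar> (max B1 B2)" if "s \<in> {a<..<b} \<inter> {0..T}" for s
      using that a(2)[of s] b(2)[of s] by (cases s t rule: linorder_cases) (auto simp: le_max_iff_disj)
    then show ?thesis
      using a(1) b(1) by (intro exI[of _ "{a<..<b}"] exI[of _ "max \<bar>f t\<bar> (max B1 B2)"]) auto
  qed
  then obtain U B where U: "\<And>t. t \<in> {0..T} \<Longrightarrow> open (U t) \<and> t \<in> U t \<and> (\<forall>s\<in>U t \<inter> {0..T}. \<bar>f s\<bar> \<le> B t)"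
    by metis
  obtain I where I: "I \<subseteq> {0..T}" "finite I" "{0..T} \<subseteq> (\<Union>t\<in>I. U t)"
    by (rule compactE_image[of "{0..T}" "{0..T}" U]) (use U in auto)
  show ?thesis
  proof (rule that[of "\<Sum>t\<in>I. \<bar>B t\<bar>"])
    fix s assume s: "s \<in> {0..T}"
    then obtain t where t: "t \<in> I" "s \<in> U t" using I(3) by auto
    then have "\<bar>f s\<bar> \<le> \<bar>B t\<bar>" using U[of t] I(1) s by force
    also have "\<dots> \<le> (\<Sum>t\<in>I. \<bar>B t\<bar>)" using I(2) t(1) by (intro member_le_sum) auto
    finally show "\<bar>f s\<bar> \<le> (\<Sum>t\<in>I. \<bar>B t\<bar>)" .
  qed
qed

lemma tendsto_compose_within_insert:
  fixes f :: "real \<Rightarrow> real"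
  assumes f: "(f \<longlongrightarrow> f t) (at t within S)" and s: "s \<longlonglongrightarrow> t" "\<And>n. s n \<in> insert t S"
  shows "(\<lambda>n. f (s n)) \<longlonglongrightarrow> f t"
proof -
  have "at t within insert t S = at t within S"
    unfolding at_within_def by (simp add: insert_Diff_if)
  then have "continuous (at t within insert t S) f"
    using f by (simp add: continuous_within)
  then show ?thesis
    by (rule continuous_within_tendsto_compose) (use s in auto)
qed

section \<open>Measures and stopping times\<close>

text \<open>
  The sigma-algebra generated by $X_s$, $s \in S$. Both the natural filtration of $X$ and the
  one of its discretisation have this form, with the \<^emph>\<open>same\<close> process and
  different index sets, so that comparing filtrations reduces to comparing index sets.
\<close>

definition generated :: "'a measure \<Rightarrow> ('i \<Rightarrow> 'a \<Rightarrow> real) \<Rightarrow> 'i set \<Rightarrow> 'a measure" where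
  "generated M X S = sigma (space M) {X s -` A \<inter> space M |s A. s \<in> S \<and> A \<in> sets borel}"

lemma space_generated [simp]: "space (generated M X S) = space M"
  unfolding generated_def by (rule space_measure_of) auto

lemma sets_generated:
  "sets (generated M X S) = sigma_sets (space M) {X s -` A \<inter> space M |s A. s \<in> S \<and> A \<in> sets borel}"
  unfolding generated_def by (rule sets_measure_of) auto

lemma generated_measurable: "s \<in> S \<Longrightarrow> X s \<in> borel_measurable (generated M X S)"
  by (rule measurableI) (auto simp: sets_generated intro: sigma_sets.Basic)

lemma generated_least:
  assumes "space N = space M" "\<And>s. s \<in> S \<Longrightarrow> X s \<in> borel_measurable N"
  shows "sets (generated M X S) \<subseteq> sets N"
  unfolding sets_generated assms(1)[symmetric]
  by (rule sets.sigma_sets_subset) (use assms(2) measurable_sets in blast)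

lemma generated_mono: "S \<subseteq> S' \<Longrightarrow> sets (generated M X S) \<subseteq> sets (generated M X S')"
  by (rule generated_least) (auto intro: generated_measurable)

lemma natural_filtration_eq: "natural_filtration M T X t = generated M X {0..min t T}"
  by (simp add: natural_filtration_def generated_def)

text \<open>
  Each value of the discretised process up to time $t$ is $X$ at some partition point before
  $t$, and conversely every such point is its own last partition point.
\<close>

lemma natural_filtration_discretization:
  assumes p: "subdivision T p"
  shows "natural_filtration M T (discretization T p X) t = generated M X (p \<inter> {..t})"
proof -
  have "{discretization T p X s -` A \<inter> space M |s A. s \<in> {0..min t T} \<and> A \<in> sets borel}
      = {X s -` A \<inter> space M |s A. s \<in> p \<inter> {..t} \<and> A \<in> sets borel}" (is "?L = ?R")
  proof (intro equalityI subsetI)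
    fix Y assume "Y \<in> ?L"
    then obtain s A where sA: "s \<in> {0..min t T}" "A \<in> sets borel"
      "Y = discretization T p X s -` A \<inter> space M" by blast
    then have s: "s \<in> {0..T}" by auto
    have "Y = X (last_point p s) -` A \<inter> space M"
      using discretization_eq_last_point[OF p s, of X] sA by auto
    moreover have "last_point p s \<in> p \<inter> {..t}"
      using last_point_le[OF p s] sA by auto
    ultimately show "Y \<in> ?R" using sA(2) by blast
  next
    fix Y assume "Y \<in> ?R"
    then obtain r A where rA: "r \<in> p \<inter> {..t}" "A \<in> sets borel" "Y = X r -` A \<inter> space M" by blast
    then have r: "r \<in> {0..T}" using p by (auto simp: subdivision_def)
    have "Y = discretization T p X r -` A \<inter> space M"
      using discretization_eq_last_point[OF p r, of X] rA subdivision_fixed_point[OF p] by auto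
    moreover have "r \<in> {0..min t T}" using r rA by auto
    ultimately show "Y \<in> ?L" using rA(2) by blast
  qed
  then show ?thesis by (simp add: natural_filtration_def generated_def)
qed

lemma space_right_limit_filtration:
  assumes "\<And>t. space (F t) = \<Omega>"
  shows "space (right_limit_filtration F t) = \<Omega>"
proof -
  have "(\<Inter>s\<in>{t<..}. sets (F s)) \<subseteq> Pow \<Omega>"
    using sets.space_closed[of "F (t + 1)"] assms by fastforce
  then show ?thesis unfolding right_limit_filtration_def assms by (rule space_measure_of)
qed

lemma sets_right_limit_filtration:
  assumes "\<And>t. space (F t) = \<Omega>"
  shows "sets (right_limit_filtration F t) = sigma_sets \<Omega> (\<Inter>s\<in>{t<..}. sets (F s))"
proof -
  have "(\<Inter>s\<in>{t<..}. sets (F s)) \<subseteq> Pow \<Omega>"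
    using sets.space_closed[of "F (t + 1)"] assms by fastforce
  then show ?thesis unfolding right_limit_filtration_def assms by (rule sets_measure_of)
qed

lemma right_limit_filtration_subset:
  assumes sp: "\<And>t. space (F t) = \<Omega>" and "t < s"
  shows "sets (right_limit_filtration F t) \<subseteq> sets (F s)"
  unfolding sets_right_limit_filtration[OF sp] sp[of s, symmetric]
  using assms(2) by (intro sets.sigma_sets_subset) auto

lemma subset_right_limit_filtration:
  assumes sp: "\<And>t. space (F t) = \<Omega>" and "\<And>s. t < s \<Longrightarrow> sets (F t) \<subseteq> sets (F s)"
  shows "sets (F t) \<subseteq> sets (right_limit_filtration F t)"
  unfolding sets_right_limit_filtration[OF sp] using assms(2) by (auto intro: sigma_sets.Basic)

lemma stopping_time_iff:
  assumes "\<And>t. space (F t) = \<Omega>"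
  shows "stopping_time F \<tau> \<longleftrightarrow> (\<forall>t. {\<omega> \<in> \<Omega>. \<tau> \<omega> \<le> t} \<in> sets (F t))"
  by (simp add: stopping_time_def pred_def assms)

text \<open>
  A strict inequality $\tau < r$ is witnessed at some time strictly before $r$. This is how
  right limits of a filtration disappear, and also why a filtration that is constant on a cell
  decides $\tau < b$ from its left end.
\<close>

lemma stopping_time_less_sets:
  fixes \<tau> :: "'a \<Rightarrow> real"
  assumes sp: "\<And>t. space (F t) = \<Omega>" and \<tau>: "stopping_time F \<tau>"
    and sub: "\<And>s. s < r \<Longrightarrow> sets (F s) \<subseteq> sets N"
  shows "{\<omega> \<in> \<Omega>. \<tau> \<omega> < r} \<in> sets N"
proof -
  have "\<exists>k. \<tau> \<omega> \<le> r - inverse (real (Suc k))" if "\<tau> \<omega> < r" for \<omega>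
    using reals_Archimedean[of "r - \<tau> \<omega>"] that by (auto intro!: less_imp_le simp: algebra_simps)
  moreover have "\<tau> \<omega> < r" if "\<tau> \<omega> \<le> r - inverse (real (Suc k))" for \<omega> k
  proof -
    have "inverse (real (Suc k)) > 0" by simp
    then show ?thesis using that by linarith
  qed
  ultimately have "{\<omega> \<in> \<Omega>. \<tau> \<omega> < r} = (\<Union>k. {\<omega> \<in> \<Omega>. \<tau> \<omega> \<le> r - inverse (real (Suc k))})"
    by blast
  moreover have "{\<omega> \<in> \<Omega>. \<tau> \<omega> \<le> r - inverse (real (Suc k))} \<in> sets N" for k
    using \<tau> sub[of "r - inverse (real (Suc k))"] by (auto simp: stopping_time_iff[OF sp])
  ultimately show ?thesis by auto
qed

lemma stopping_time_borel_measurable: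
  fixes \<tau> :: "'a \<Rightarrow> real"
  assumes sp: "\<And>t. space (F t) = space M" and "stopping_time F \<tau>"
    and "\<And>t. sets (F t) \<subseteq> sets M"
  shows "\<tau> \<in> borel_measurable M"
  using assms(2,3) unfolding borel_measurable_iff_le stopping_time_iff[OF sp] by blast

text \<open>
  The first grid point $r \in Q$ whose event \<open>A r\<close> occurs, capped at $L$. Every
  time with values in $Q \cup \{L\}$ bounded by $L$ is of this form. No event is attached to $L$
  itself, which is therefore free not to be a partition point.
\<close>

definition first_entry :: "real set \<Rightarrow> real \<Rightarrow> (real \<Rightarrow> 'a set) \<Rightarrow> 'a \<Rightarrow> real" where
  "first_entry Q L A \<omega> = Min (insert L {r \<in> Q. \<omega> \<in> A r})"

lemma first_entry_in: "finite Q \<Longrightarrow> first_entry Q L A \<omega> \<in> insert L {r \<in> Q. \<omega> \<in> A r}"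
  unfolding first_entry_def by (rule Min_in) auto

lemma first_entry_le_iff:
  "finite Q \<Longrightarrow> first_entry Q L A \<omega> \<le> t \<longleftrightarrow> L \<le> t \<or> (\<exists>r\<in>Q. \<omega> \<in> A r \<and> r \<le> t)"
  unfolding first_entry_def by (subst Min_le_iff) auto

lemma first_entry_stopping_time:
  assumes sp: "\<And>t. space (F t) = \<Omega>" and fin: "finite Q"
    and A: "\<And>r t. r \<in> Q \<Longrightarrow> r \<le> t \<Longrightarrow> A r \<in> sets (F t)"
  shows "stopping_time F (first_entry Q L A)"
  unfolding stopping_time_iff[OF sp] first_entry_le_iff[OF fin]
proof
  fix t
  show "{\<omega> \<in> \<Omega>. L \<le> t \<or> (\<exists>r\<in>Q. \<omega> \<in> A r \<and> r \<le> t)} \<in> sets (F t)"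
  proof (cases "L \<le> t")
    case True
    then show ?thesis using sets.top[of "F t"] sp by simp
  next
    case False
    then have "{\<omega> \<in> \<Omega>. L \<le> t \<or> (\<exists>r\<in>Q. \<omega> \<in> A r \<and> r \<le> t)} = (\<Union>r\<in>Q \<inter> {..t}. A r)"
      using A[THEN sets.sets_into_space] sp by fastforce
    then show ?thesis using A fin by (auto intro!: sets.finite_UN)
  qed
qed

text \<open>
  The sets that can be approximated form a sigma-algebra: complementation preserves symmetric
  differences, and a countable union is approximated by a finite one, whose members can all be
  approximated at one common stage because the stages increase.
\<close>

lemma (in finite_measure) approximation_by_increasing_union:
  assumes mono: "\<And>m n. m \<le> n \<Longrightarrow> sets (G m) \<subseteq> sets (G (n::nat))"
    and sp: "\<And>n. space (G n) = space M" and sub: "\<And>n. sets (G n) \<subseteq> sets M"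
    and A: "A \<in> sigma_sets (space M) (\<Union>n. sets (G n))" and e: "e > 0"
  shows "\<exists>n. \<exists>B\<in>sets (G n). measure M ((A - B) \<union> (B - A)) < e"
  using A e
proof (induction arbitrary: e rule: sigma_sets.induct)
  case (Basic a)
  then show ?case by (metis Diff_cancel UN_iff measure_empty sup.idem)
next
  case Empty
  then show ?case by (metis Diff_cancel measure_empty sets.empty_sets sup.idem)
next
  case (Compl a)
  then obtain n B where B: "B \<in> sets (G n)" "measure M ((a - B) \<union> (B - a)) < e" by blast
  have "a \<subseteq> space M"
    using Compl.hyps sigma_sets_into_sp[of "\<Union>n. sets (G n)" "space M"] sets.sets_into_space sp
    by fastforce
  moreover have "B \<subseteq> space M" using B(1) sets.sets_into_space sp by metis
  ultimately have "((space M - a) - (space M - B)) \<union> ((space M - B) - (space M - a)) = (a - B) \<union> (B - a)"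
    by auto
  moreover have "space M - B \<in> sets (G n)" using B(1) sets.compl_sets sp by metis
  ultimately show ?case using B(2) by metis
next
  case (Union a)
  have aM: "a i \<in> sets M" for i
    using Union.hyps[of i] sets.sigma_sets_subset[of "\<Union>n. sets (G n)" M] sub by blast
  define U where "U N = (\<Union>i<N. a i)" for N :: nat
  have UM: "U N \<in> sets M" "(\<Union>i. a i) \<in> sets M" for N using aM by (auto simp: U_def)
  have "(\<lambda>N. measure M (U N)) \<longlonglongrightarrow> measure M (\<Union>N. U N)"
    using UM(1) by (intro finite_Lim_measure_incseq) (force simp: incseq_def U_def)+
  also have "(\<Union>N. U N) = (\<Union>i. a i)" by (auto simp: U_def)
  finally have "\<forall>\<^sub>F N in sequentially. measure M (U N) > measure M (\<Union>i. a i) - e / 2"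
    using Union.prems by (intro order_tendstoD) auto
  then obtain N where N: "measure M (U N) > measure M (\<Union>i. a i) - e / 2"
    by (auto dest: eventually_happens)
  have "measure M ((\<Union>i. a i) - U N) = measure M (\<Union>i. a i) - measure M (U N)"
    using UM by (intro finite_measure_Diff) (auto simp: U_def)
  with N have tail: "measure M ((\<Union>i. a i) - U N) < e / 2" by linarith
  define d where "d = e / (2 * (real N + 1))"
  have "d > 0" using Union.prems by (simp add: d_def)
  then have "\<forall>i. \<exists>n B. B \<in> sets (G n) \<and> measure M ((a i - B) \<union> (B - a i)) < d"
    using Union.IH by blast
  then obtain n B where B: "\<And>i. B i \<in> sets (G (n i))"
      "\<And>i. measure M ((a i - B i) \<union> (B i - a i)) < d" by metis
  define m where "m = Max (insert 0 (n ` {..<N}))"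
  have "n i \<le> m" if "i < N" for i using that by (auto simp: m_def)
  then have Bm: "B i \<in> sets (G m)" if "i < N" for i using that B(1) mono by blast
  have BM: "B i \<in> sets M" for i using B(1) sub by blast
  let ?B = "\<Union>i<N. B i"
  let ?D = "\<lambda>i. (a i - B i) \<union> (B i - a i)"
  have "measure M (((\<Union>i. a i) - ?B) \<union> (?B - (\<Union>i. a i)))
      \<le> measure M (((\<Union>i. a i) - U N) \<union> (\<Union>i<N. ?D i))"
    using UM aM BM by (intro finite_measure_mono) (auto simp: U_def)
  also have "\<dots> \<le> measure M ((\<Union>i. a i) - U N) + measure M (\<Union>i<N. ?D i)"
    using UM aM BM by (intro measure_Un_le) auto
  also have "measure M (\<Union>i<N. ?D i) \<le> (\<Sum>i<N. measure M (?D i))"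
    using aM BM by (intro measure_UNION_le) auto
  also have "\<dots> \<le> (\<Sum>i<N. d)" using B(2) by (intro sum_mono less_imp_le)
  also have "\<dots> \<le> e / 2" using Union.prems by (simp add: d_def field_simps)
  finally have "measure M (((\<Union>i. a i) - ?B) \<union> (?B - (\<Union>i. a i))) < e" using tail by simp
  moreover have "?B \<in> sets (G m)" using Bm by auto
  ultimately show ?case by blast
qed

lemma borel_measurable_at_finite_valued_time:
  assumes fin: "finite I" and \<sigma>: "\<sigma> \<in> borel_measurable M" "\<And>\<omega>. \<omega> \<in> space M \<Longrightarrow> \<sigma> \<omega> \<in> I"
    and Y: "\<And>r::real. r \<in> I \<Longrightarrow> Y r \<in> borel_measurable M"
  shows "(\<lambda>\<omega>. Y (\<sigma> \<omega>) \<omega> :: real) \<in> borel_measurable M"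
proof (rule measurable_compose_countable'[OF Y])
  show "\<sigma> \<in> measurable M (count_space I)"
    unfolding measurable_count_space_eq2[OF fin] using \<sigma> by (auto intro: measurable_sets)
qed (use fin in \<open>auto intro: countable_finite\<close>)

lemma borel_measurable_continuous_pair:
  fixes g :: "real \<times> real \<Rightarrow> real"
  assumes "continuous_on UNIV g" "u \<in> borel_measurable M" "v \<in> borel_measurable M"
  shows "(\<lambda>\<omega>. g (u \<omega>, v \<omega>)) \<in> borel_measurable M"
proof (rule measurable_compose[OF _ borel_measurable_continuous_onI[OF assms(1)]])
  show "(\<lambda>\<omega>. (u \<omega>, v \<omega>)) \<in> borel_measurable M"
    using assms(2,3) by (simp add: borel_prod[symmetric])
qed

lemma (in prob_space) bounded_convergence:
  fixes f :: "nat \<Rightarrow> 'a \<Rightarrow> real"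
  assumes "\<And>n. f n \<in> borel_measurable M" "h \<in> borel_measurable M"
    and "AE \<omega> in M. (\<lambda>n. f n \<omega>) \<longlonglongrightarrow> h \<omega>" "\<And>n \<omega>. \<omega> \<in> space M \<Longrightarrow> \<bar>f n \<omega>\<bar> \<le> C"
  shows "(\<lambda>n. \<integral>\<omega>. f n \<omega> \<partial>M) \<longlonglongrightarrow> (\<integral>\<omega>. h \<omega> \<partial>M)"
  by (rule integral_dominated_convergence[where w = "\<lambda>_. C"]) (use assms in auto)

lemma (in prob_space) integral_differ_on_set:
  fixes f h :: "'a \<Rightarrow> real"
  assumes f: "f \<in> borel_measurable M" "h \<in> borel_measurable M"
    and b: "\<And>\<omega>. \<omega> \<in> space M \<Longrightarrow> \<bar>f \<omega>\<bar> \<le> C" "\<And>\<omega>. \<omega> \<in> space M \<Longrightarrow> \<bar>h \<omega>\<bar> \<le> C"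
    and D: "D \<in> sets M" "\<And>\<omega>. \<omega> \<in> space M \<Longrightarrow> \<omega> \<notin> D \<Longrightarrow> f \<omega> = h \<omega>"
  shows "\<bar>(\<integral>\<omega>. f \<omega> \<partial>M) - (\<integral>\<omega>. h \<omega> \<partial>M)\<bar> \<le> 2 * C * measure M D"
proof -
  have int: "integrable M f" "integrable M h"
    using f b by (auto intro!: integrable_const_bound[where B = C])
  have "\<bar>(\<integral>\<omega>. f \<omega> \<partial>M) - (\<integral>\<omega>. h \<omega> \<partial>M)\<bar> = \<bar>\<integral>\<omega>. f \<omega> - h \<omega> \<partial>M\<bar>"
    using int by simp
  also have "\<dots> \<le> (\<integral>\<omega>. \<bar>f \<omega> - h \<omega>\<bar> \<partial>M)" by (rule integral_abs_bound)
  also have "\<dots> \<le> (\<integral>\<omega>. 2 * C * indicator D \<omega> \<partial>M)"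
  proof (rule integral_mono)
    show "integrable M (\<lambda>\<omega>. 2 * C * indicator D \<omega>)" using D(1) by (simp add: emeasure_eq_measure)
    show "\<bar>f \<omega> - h \<omega>\<bar> \<le> 2 * C * indicator D \<omega>" if "\<omega> \<in> space M" for \<omega>
      using b[OF that] D(2)[OF that] by (cases "\<omega> \<in> D") auto
  qed (use int in auto)
  also have "\<dots> = 2 * C * measure M D" using D(1) by simp
  finally show ?thesis .
qed


lemma (in prob_space) abs_integral_le:
  fixes f :: "'a \<Rightarrow> real"
  assumes "\<And>\<omega>. \<omega> \<in> space M \<Longrightarrow> \<bar>f \<omega>\<bar> \<le> C" 
  shows "\<bar>\<integral>\<omega>. f \<omega> \<partial>M\<bar> \<le> C"
proof (cases "integrable M f")
  case True
  have "\<bar>\<integral>\<omega>. f \<omega> \<partial>M\<bar> \<le> (\<integral>\<omega>. \<bar>f \<omega>\<bar> \<partial>M)" by (rule integral_abs_bound)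
  also have "\<dots> \<le> (\<integral>\<omega>. C \<partial>M)" using True assms by (intro integral_mono) auto
  finally show ?thesis by (simp add: prob_space)
next
  case False
  obtain \<omega> where "\<omega> \<in> space M" using not_empty by auto
  then have "0 \<le> C" using assms[of \<omega>] by linarith
  then show ?thesis using False by (simp add: not_integrable_integral_eq)
qed

section \<open>Values of optimal stopping\<close>

text \<open>
  The reward is taken continuous and bounded on the whole plane. A reward given for nonnegative
  times only is brought into this form by freezing it at time $0$ for negative times.
\<close>

locale bounded_reward = prob_space M for M :: "'a measure" +
  fixes g :: "real \<times> real \<Rightarrow> real" and C L :: real
  assumes g_bound: "\<And>z. \<bar>g z\<bar> \<le> C" and g_cont: "continuous_on UNIV g" and L_nonneg: "0 \<le> L"
begin

definition admissible :: "(real \<Rightarrow> 'a measure) \<Rightarrow> ('a \<Rightarrow> real) \<Rightarrow> bool" where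
  "admissible F \<tau> \<longleftrightarrow> stopping_time F \<tau> \<and> (\<forall>\<omega>\<in>space M. \<tau> \<omega> \<in> {0..L})"

definition payoff :: "(real \<Rightarrow> 'a \<Rightarrow> real) \<Rightarrow> ('a \<Rightarrow> real) \<Rightarrow> real" where
  "payoff Y \<tau> = (\<integral>\<omega>. g (\<tau> \<omega>, Y (\<tau> \<omega>) \<omega>) \<partial>M)"

lemma stopping_value_eq: "stopping_value M g F Y L = (SUP \<tau>\<in>Collect (admissible F). payoff Y \<tau>)"
  by (simp only: stopping_value_def admissible_def[abs_def] payoff_def[abs_def])

lemma payoff_bdd: "bdd_above (payoff Y ` A)"
proof -
  have "\<bar>payoff Y \<tau>\<bar> \<le> C" for \<tau>
    unfolding payoff_def by (rule abs_integral_le) (rule g_bound)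
  then show ?thesis by (intro bdd_aboveI2[where M = C]) (auto simp: abs_le_iff)
qed

lemma payoff_le_stopping_value:
  "admissible F \<tau> \<Longrightarrow> payoff Y \<tau> \<le> stopping_value M g F Y L"
  unfolding stopping_value_eq by (rule cSUP_upper) (auto intro: payoff_bdd)

lemma near_optimal_stopping_time:
  assumes "e > 0"
  obtains \<tau> where "admissible F \<tau>" "stopping_value M g F Y L - e < payoff Y \<tau>"
proof -
  have "admissible F (\<lambda>_. 0)"
    using L_nonneg by (auto simp: admissible_def stopping_time_def)
  then have "Collect (admissible F) \<noteq> {}" by auto
  then have "\<exists>\<tau>\<in>Collect (admissible F). stopping_value M g F Y L - e < payoff Y \<tau>"
    using assms unfolding stopping_value_eq by (subst less_cSUP_iff[symmetric]) (auto intro: payoff_bdd)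
  then show ?thesis using that by blast
qed

end

section \<open>Filtrations of the discretised process\<close>

locale cadlag_discretization = prob_space M for M :: "'a measure" +
  fixes T :: real and X :: "real \<Rightarrow> 'a \<Rightarrow> real" and \<pi> :: "nat \<Rightarrow> real set"
  assumes T_pos: "T > 0"
    and cadlag: "cadlag_process M T X"
    and no_fixed_jump: "\<And>t. t \<in> {0..T} \<Longrightarrow> measure M {\<omega> \<in> space M. jump X t \<omega> \<noteq> 0} = 0"
    and subdivision: "\<And>n. subdivision T (\<pi> n)"
    and refining: "incseq \<pi>"
    and mesh_0: "(\<lambda>n. mesh (\<pi> n)) \<longlonglongrightarrow> 0"
begin

abbreviation "X\<^sub>D n \<equiv> discretization T (\<pi> n) X"
abbreviation "\<F>\<^sub>D n \<equiv> natural_filtration M T (X\<^sub>D n)"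
abbreviation "\<F>\<^sub>X \<equiv> natural_filtration M T X"
abbreviation "\<F> \<equiv> right_limit_filtration \<F>\<^sub>X"

lemma X_measurable: "t \<in> {0..T} \<Longrightarrow> X t \<in> borel_measurable M"
  using cadlag by (auto simp: cadlag_process_def)

lemma path_cadlag: "\<omega> \<in> space M \<Longrightarrow> cadlag T (\<lambda>t. X t \<omega>)"
  using cadlag by (auto simp: cadlag_process_def)

lemma points: "finite (\<pi> n)" "\<pi> n \<subseteq> {0..T}" "T \<in> \<pi> n"
  using subdivision[of n] by (auto simp: subdivision_def)

lemma space_filtrations [simp]:
  "space (\<F>\<^sub>D n t) = space M" "space (\<F>\<^sub>X t) = space M" "space (\<F> t) = space M"
proof -
  have *: "space (\<F>\<^sub>X t) = space M" for t by (simp add: natural_filtration_eq)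
  show "space (\<F>\<^sub>X t) = space M" by (rule *)
  show "space (\<F> t) = space M" by (rule space_right_limit_filtration) (rule *)
qed (simp add: natural_filtration_eq)

lemma \<F>\<^sub>D_eq: "\<F>\<^sub>D n t = generated M X (\<pi> n \<inter> {..t})"
  by (rule natural_filtration_discretization) (rule subdivision)

lemma \<F>\<^sub>D_mono: "m \<le> n \<Longrightarrow> s \<le> t \<Longrightarrow> sets (\<F>\<^sub>D m s) \<subseteq> sets (\<F>\<^sub>D n t)"
  unfolding \<F>\<^sub>D_eq using incseqD[OF refining, of m n] by (intro generated_mono) auto

lemma \<F>\<^sub>X_mono: "s \<le> t \<Longrightarrow> sets (\<F>\<^sub>X s) \<subseteq> sets (\<F>\<^sub>X t)"
  unfolding natural_filtration_eq by (intro generated_mono) auto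

lemma \<F>\<^sub>D_le_\<F>\<^sub>X: "sets (\<F>\<^sub>D n t) \<subseteq> sets (\<F>\<^sub>X t)"
  unfolding \<F>\<^sub>D_eq unfolding natural_filtration_eq
  using points(2)[of n] by (intro generated_mono) auto

lemma \<F>\<^sub>X_le_\<F>: "sets (\<F>\<^sub>X t) \<subseteq> sets (\<F> t)"
  by (rule subset_right_limit_filtration[where \<Omega> = "space M"]) (auto dest: \<F>\<^sub>X_mono[OF less_imp_le])

lemma \<F>_le_\<F>\<^sub>X: "s < t \<Longrightarrow> sets (\<F> s) \<subseteq> sets (\<F>\<^sub>X t)"
  by (rule right_limit_filtration_subset[where \<Omega> = "space M"]) auto

lemma \<F>\<^sub>X_le_M: "sets (\<F>\<^sub>X t) \<subseteq> sets M"
  unfolding natural_filtration_eq by (rule generated_least) (auto intro: X_measurable)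

lemma \<F>\<^sub>D_le_M: "sets (\<F>\<^sub>D n t) \<subseteq> sets M"
  using \<F>\<^sub>D_le_\<F>\<^sub>X \<F>\<^sub>X_le_M by blast

lemma stopping_time_\<F>\<^sub>D_imp_\<F>: "stopping_time (\<F>\<^sub>D n) \<tau> \<Longrightarrow> stopping_time \<F> \<tau>"
  unfolding stopping_time_iff[of "\<F>\<^sub>D n" "space M", OF space_filtrations(1)]
    stopping_time_iff[of \<F> "space M", OF space_filtrations(3)]
  using \<F>\<^sub>D_le_\<F>\<^sub>X \<F>\<^sub>X_le_\<F> by blast

text \<open>
  For $t$ in a cell $[a,b)$ the rounded time is at most $t$ exactly when $\tau < b$. The
  filtration of the discretised process does not change on the cell, so the information
  available before $b$ is already available at $t$.
\<close>

lemma last_point_stopping_time: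
  assumes \<tau>: "stopping_time (\<F>\<^sub>D n) \<tau>" and range: "\<And>\<omega>. \<omega> \<in> space M \<Longrightarrow> \<tau> \<omega> \<in> {0..T}"
  shows "stopping_time (\<F>\<^sub>D n) (\<lambda>\<omega>. last_point (\<pi> n) (\<tau> \<omega>))"
  unfolding stopping_time_iff[of "\<F>\<^sub>D n" "space M", OF space_filtrations(1)]
proof
  fix t
  have lp: "last_point (\<pi> n) (\<tau> \<omega>) \<in> {0..T}" if "\<omega> \<in> space M" for \<omega>
    using last_point_le(2)[OF subdivision range[OF that]] points(2) by blast
  consider "t < 0" | "T \<le> t" | "t \<in> {0..<T}" by fastforce
  then show "{\<omega> \<in> space M. last_point (\<pi> n) (\<tau> \<omega>) \<le> t} \<in> sets (\<F>\<^sub>D n t)"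
  proof cases
    case 1
    then have "{\<omega> \<in> space M. last_point (\<pi> n) (\<tau> \<omega>) \<le> t} = {}" using lp by fastforce
    then show ?thesis by (metis sets.empty_sets)
  next
    case 2
    then have "{\<omega> \<in> space M. last_point (\<pi> n) (\<tau> \<omega>) \<le> t} = space (\<F>\<^sub>D n t)" using lp by fastforce
    then show ?thesis by (metis sets.top)
  next
    case 3
    obtain b where b: "\<And>s. s \<in> {0..T} \<Longrightarrow> last_point (\<pi> n) s \<le> t \<longleftrightarrow> s < b"
      "\<And>s. s \<in> \<pi> n \<Longrightarrow> s < b \<Longrightarrow> s \<le> t"
      using last_point_cell[OF subdivision 3] by metis
    have "{\<omega> \<in> space M. last_point (\<pi> n) (\<tau> \<omega>) \<le> t} = {\<omega> \<in> space M. \<tau> \<omega> < b}"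
      using b(1) range by blast
    moreover have "{\<omega> \<in> space M. \<tau> \<omega> < b} \<in> sets (\<F>\<^sub>D n t)"
    proof (rule stopping_time_less_sets[OF _ \<tau>])
      show "sets (\<F>\<^sub>D n s) \<subseteq> sets (\<F>\<^sub>D n t)" if "s < b" for s
        unfolding \<F>\<^sub>D_eq using b(2) that by (intro generated_mono) fastforce
    qed simp
    ultimately show ?thesis by simp
  qed
qed

text \<open>
  The last partition points increase to $r$ from the left, possibly being equal to $r$. The
  discretised values therefore converge to $X_r$ as soon as $X_{r-} = X_r$.
\<close>

lemma fixed_time_convergence:
  assumes r: "r \<in> {0..T}"
  shows "AE \<omega> in M. (\<lambda>n. X\<^sub>D n r \<omega>) \<longlonglongrightarrow> X r \<omega>"
proof -
  have lp_le: "last_point (\<pi> n) r \<le> r" for n using last_point_le(1)[OF subdivision r] .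
  have lp: "(\<lambda>n. last_point (\<pi> n) r) \<longlonglongrightarrow> r"
  proof (rule tendsto_sandwich)
    show "(\<lambda>n. r - mesh (\<pi> n)) \<longlonglongrightarrow> r" using tendsto_diff[OF tendsto_const mesh_0, of r] by simp
    show "\<forall>\<^sub>F n in sequentially. r - mesh (\<pi> n) \<le> last_point (\<pi> n) r"
      using last_point_close[OF subdivision T_pos r] by simp
  qed (use lp_le in auto)
  have "AE \<omega> in M. ((\<lambda>t. X t \<omega>) \<longlongrightarrow> X r \<omega>) (at_left r)" if "r > 0"
  proof -
    define s where "s k = r - r / (real k + 2)" for k :: nat
    have "0 < r / (real k + 2)" "r / (real k + 2) \<le> r" for k
      using that by (auto simp: divide_le_eq algebra_simps)
    then have s_pos: "0 \<le> s k" and s_less: "s k < r" for k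
      by (auto simp: s_def)
    have s_range: "s k \<in> {0..T}" "s k < r" for k
      using s_pos[of k] s_less[of k] r by auto
    have "s \<longlonglongrightarrow> r" unfolding s_def by real_asymp
    then have s: "filterlim s (at_left r) sequentially"
      unfolding filterlim_at using s_range(2) by (auto intro!: always_eventually less_imp_neq)
    have left: "((\<lambda>t. X t \<omega>) \<longlongrightarrow> Lim (at_left r) (\<lambda>t. X t \<omega>)) (at_left r)" if \<omega>: "\<omega> \<in> space M" for \<omega>
    proof -
      have "r \<in> {0<..T}" using r \<open>r > 0\<close> by auto
      then obtain l where l: "((\<lambda>t. X t \<omega>) \<longlongrightarrow> l) (at_left r)"
        using path_cadlag[OF \<omega>] unfolding cadlag_def by blast
      then have "Lim (at_left r) (\<lambda>t. X t \<omega>) = l" by (intro tendsto_Lim) auto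
      then show ?thesis using l by simp
    qed
    have Lim_eq: "Lim (at_left r) (\<lambda>t. X t \<omega>) = lim (\<lambda>k. X (s k) \<omega>)" if "\<omega> \<in> space M" for \<omega>
      using filterlim_compose[OF left[OF that] s] by (metis limI)
    \<comment> \<open>Non-measurable sets have measure $0$ by convention, so measurability must be shown to
      get a null set; hence the left limit is computed along a sequence.\<close>
    have "{\<omega> \<in> space M. jump X r \<omega> \<noteq> 0} = {\<omega> \<in> space M. X r \<omega> \<noteq> lim (\<lambda>k. X (s k) \<omega>)}"
      using Lim_eq that by (auto simp: jump_def)
    also have "\<dots> \<in> sets M"
    proof -
      have [measurable]: "X r \<in> borel_measurable M" "\<And>k. X (s k) \<in> borel_measurable M"
        using X_measurable r s_range by auto
      have [measurable]: "(\<lambda>\<omega>. lim (\<lambda>k. X (s k) \<omega>)) \<in> borel_measurable M"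
        by (rule borel_measurable_lim_metric) simp
      show ?thesis by measurable
    qed
    finally have "AE \<omega> in M. jump X r \<omega> = 0"
      using no_fixed_jump[OF r] by (subst AE_iff_measurable[OF _ refl]) (auto simp: emeasure_eq_measure)
    then show ?thesis
    proof (rule AE_mp, intro AE_I2 impI)
      fix \<omega> assume "\<omega> \<in> space M" "jump X r \<omega> = 0"
      then show "((\<lambda>t. X t \<omega>) \<longlongrightarrow> X r \<omega>) (at_left r)"
        using left[of \<omega>] that by (simp add: jump_def)
    qed
  qed
  moreover have "(\<lambda>n. X\<^sub>D n r \<omega>) \<longlonglongrightarrow> X r \<omega>"
    if "((\<lambda>t. X t \<omega>) \<longlongrightarrow> X r \<omega>) (at_left r)" for \<omega>
    unfolding discretization_eq_last_point[OF subdivision r]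
    by (rule tendsto_compose_within_insert[OF that lp]) (use lp_le in \<open>auto simp: order_le_less\<close>)
  moreover have "(\<lambda>n. X\<^sub>D n r \<omega>) \<longlonglongrightarrow> X r \<omega>" if "\<not> r > 0" for \<omega>
  proof -
    have "r = 0" using r that by auto
    moreover have "last_point (\<pi> n) 0 = 0" for n
      using subdivision[of n] by (intro subdivision_fixed_point[of T]) (auto simp: subdivision_def)
    ultimately show ?thesis
      using discretization_eq_last_point[OF subdivision r, where X = X] by simp
  qed
  ultimately show ?thesis by (cases "r > 0") auto
qed

text \<open>
  For $t < r$ the value $X_t$ is the limit of values of $X$ at partition points decreasing to
  $t$, and these can be kept in $(t,r]$ because $r$ is a partition point. For $t = r$ there is
  no room to the right, but $X_r$ itself is observed.
\<close>

lemma \<F>\<^sub>X_le_sigma_\<F>\<^sub>D: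
  assumes r: "r \<in> \<pi> m"
  shows "sets (\<F>\<^sub>X r) \<subseteq> sigma_sets (space M) (\<Union>n. sets (\<F>\<^sub>D n r))"
proof -
  define H where "H = sigma (space M) (\<Union>n. sets (\<F>\<^sub>D n r))"
  have Pow: "(\<Union>n. sets (\<F>\<^sub>D n r)) \<subseteq> Pow (space M)"
    using sets.sets_into_space[of _ "\<F>\<^sub>D _ r"] by fastforce
  have H: "space H = space M" "sets H = sigma_sets (space M) (\<Union>n. sets (\<F>\<^sub>D n r))"
    unfolding H_def by (rule space_measure_of[OF Pow], rule sets_measure_of[OF Pow])
  have D: "X d \<in> borel_measurable H" if "d \<in> \<pi> n" "d \<le> r" for d n
  proof -
    have "X d \<in> borel_measurable (\<F>\<^sub>D n r)"
      unfolding \<F>\<^sub>D_eq by (rule generated_measurable) (use that in auto)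
    then show ?thesis
      by (rule measurable_mono[THEN subsetD, rotated -1]) (auto simp: H intro: sigma_sets.Basic)
  qed
  have "sets (\<F>\<^sub>X r) \<subseteq> sets H"
    unfolding natural_filtration_eq
  proof (rule generated_least[OF H(1)])
    fix t assume t: "t \<in> {0..min r T}"
    show "X t \<in> borel_measurable H"
    proof (cases "t = r")
      case True
      then show ?thesis using D[OF r] by simp
    next
      case False
      then have tr: "0 \<le> t" "t < r" using t by auto
      have "\<exists>d. d \<in> \<pi> (n + m) \<and> t < d \<and> d \<le> r \<and> d \<le> t + mesh (\<pi> (n + m))" for n
      proof -
        have "r \<in> \<pi> (n + m)" using r incseqD[OF refining, of m "n + m"] by auto
        then show ?thesis by (metis next_point[OF subdivision tr])
      qed
      then obtain d where d: "\<And>n. d n \<in> \<pi> (n + m)" "\<And>n. t < d n" "\<And>n. d n \<le> r"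
        "\<And>n. d n \<le> t + mesh (\<pi> (n + m))" by metis
      have dt: "d \<longlonglongrightarrow> t"
      proof (rule tendsto_sandwich[OF _ _ tendsto_const])
        show "(\<lambda>n. t + mesh (\<pi> (n + m))) \<longlonglongrightarrow> t"
          using tendsto_add[OF tendsto_const LIMSEQ_ignore_initial_segment[OF mesh_0, of m], of t] by simp
      qed (use d(4) less_imp_le[OF d(2)] in auto)
      have "t \<in> {0..<T}" using tr t r points(2)[of m] by auto
      then have "((\<lambda>t. X t \<omega>) \<longlongrightarrow> X t \<omega>) (at_right t)" if "\<omega> \<in> space M" for \<omega>
        using path_cadlag[OF that] unfolding cadlag_def by blast
      then have conv: "(\<lambda>n. X (d n) \<omega>) \<longlonglongrightarrow> X t \<omega>" if "\<omega> \<in> space M" for \<omega>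
        using that tendsto_compose_within_insert[of "\<lambda>t. X t \<omega>" t "{t<..}" d] dt d(2) by auto
      show ?thesis
      proof (rule borel_measurable_LIMSEQ_real)
        show "(\<lambda>n. X (d n) \<omega>) \<longlonglongrightarrow> X t \<omega>" if "\<omega> \<in> space H" for \<omega>
          by (rule conv) (use that H(1) in simp)
        show "X (d n) \<in> borel_measurable H" for n
          by (rule D[OF d(1) d(3)])
      qed
    qed
  qed
  then show ?thesis using H by simp
qed

end

section \<open>Upper bound for the discretised values\<close>

locale discretized_stopping_problem =
  cadlag_discretization M T X \<pi> + bounded_reward M g C L
  for M :: "'a measure" and T :: real and X :: "real \<Rightarrow> 'a \<Rightarrow> real" and \<pi> :: "nat \<Rightarrow> real set"
    and g :: "real \<times> real \<Rightarrow> real" and C L :: real +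
  assumes L_le_T: "L \<le> T"
begin

lemma C_nonneg: "0 \<le> C"
  using g_bound[of undefined] by linarith

lemma admissible_range:
  assumes "admissible F \<tau>" "\<omega> \<in> space M"
  shows "\<tau> \<omega> \<in> {0..L}" "\<tau> \<omega> \<in> {0..T}"
  using assms L_le_T by (force simp: admissible_def)+

lemma admissible_borel:
  assumes "admissible (\<F>\<^sub>D n) \<tau>" shows "\<tau> \<in> borel_measurable M"
  by (rule stopping_time_borel_measurable[of "\<F>\<^sub>D n"]) (use assms \<F>\<^sub>D_le_M in \<open>auto simp: admissible_def\<close>)

lemma last_point_admissible:
  assumes \<tau>: "admissible (\<F>\<^sub>D n) \<tau>"
  shows "admissible (\<F>\<^sub>D n) (\<lambda>\<omega>. last_point (\<pi> n) (\<tau> \<omega>))"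
  unfolding admissible_def
proof (intro conjI ballI)
  show "stopping_time (\<F>\<^sub>D n) (\<lambda>\<omega>. last_point (\<pi> n) (\<tau> \<omega>))"
    by (rule last_point_stopping_time) (use \<tau> admissible_range(2)[OF \<tau>] in \<open>auto simp: admissible_def\<close>)
  fix \<omega> assume \<omega>: "\<omega> \<in> space M"
  show "last_point (\<pi> n) (\<tau> \<omega>) \<in> {0..L}"
    using last_point_le[OF subdivision[of n] admissible_range(2)[OF \<tau> \<omega>]]
      points(2)[of n] admissible_range(1)[OF \<tau> \<omega>] by auto
qed

lemma payoff_borel:
  assumes fin: "finite I" "I \<subseteq> {0..T}" and \<sigma>: "\<sigma> \<in> borel_measurable M" "\<And>\<omega>. \<omega> \<in> space M \<Longrightarrow> \<sigma> \<omega> \<in> I"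
    and \<rho>: "\<rho> \<in> borel_measurable M"
  shows "(\<lambda>\<omega>. g (\<rho> \<omega>, X (\<sigma> \<omega>) \<omega>)) \<in> borel_measurable M"
proof (rule borel_measurable_continuous_pair[OF g_cont \<rho>])
  show "(\<lambda>\<omega>. X (\<sigma> \<omega>) \<omega>) \<in> borel_measurable M"
    by (rule borel_measurable_at_finite_valued_time[OF fin(1) \<sigma>]) (use fin(2) X_measurable in auto)
qed

text \<open>
  Both payoffs evaluate the reward at the same space point and at times that differ by at most
  the mesh. Along a bounded path the reward is uniformly continuous, so the difference tends to
  $0$ pathwise, and boundedness passes this to the expectations.
\<close>

lemma rounding_error_vanishes:
  assumes \<tau>: "\<And>n. admissible (\<F>\<^sub>D n) (\<tau> n)"
  shows "(\<lambda>n. payoff (X\<^sub>D n) (\<tau> n) - payoff X (\<lambda>\<omega>. last_point (\<pi> n) (\<tau> n \<omega>))) \<longlonglongrightarrow> 0"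
proof -
  define \<sigma> where "\<sigma> n \<omega> = last_point (\<pi> n) (\<tau> n \<omega>)" for n \<omega>
  have \<sigma>: "\<sigma> n \<in> borel_measurable M" for n
    using admissible_borel[OF last_point_admissible[OF \<tau>, of n]] by (simp add: \<sigma>_def[abs_def])
  have \<sigma>_in: "\<sigma> n \<omega> \<in> \<pi> n" if "\<omega> \<in> space M" for n \<omega>
    unfolding \<sigma>_def by (rule last_point_le(2)[OF subdivision admissible_range(2)[OF \<tau> that]])
  have meas: "(\<lambda>\<omega>. g (\<tau> n \<omega>, X (\<sigma> n \<omega>) \<omega>)) \<in> borel_measurable M"
    "(\<lambda>\<omega>. g (\<sigma> n \<omega>, X (\<sigma> n \<omega>) \<omega>)) \<in> borel_measurable M" for n
    using payoff_borel[OF points(1,2) \<sigma> \<sigma>_in] admissible_borel[OF \<tau>] \<sigma> by auto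
  have "payoff (X\<^sub>D n) (\<tau> n) - payoff X (\<sigma> n)
      = (\<integral>\<omega>. g (\<tau> n \<omega>, X (\<sigma> n \<omega>) \<omega>) - g (\<sigma> n \<omega>, X (\<sigma> n \<omega>) \<omega>) \<partial>M)" for n
  proof -
    have "payoff (X\<^sub>D n) (\<tau> n) = (\<integral>\<omega>. g (\<tau> n \<omega>, X (\<sigma> n \<omega>) \<omega>) \<partial>M)"
      unfolding payoff_def \<sigma>_def
      by (intro Bochner_Integration.integral_cong refl)
        (simp add: discretization_eq_last_point[OF subdivision admissible_range(2)[OF \<tau>]])
    moreover have "integrable M (\<lambda>\<omega>. g (\<tau> n \<omega>, X (\<sigma> n \<omega>) \<omega>))" "integrable M (\<lambda>\<omega>. g (\<sigma> n \<omega>, X (\<sigma> n \<omega>) \<omega>))"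
      using meas g_bound by (auto intro!: integrable_const_bound[where B = C])
    ultimately show ?thesis by (simp add: payoff_def)
  qed
  moreover have "(\<lambda>n. \<integral>\<omega>. g (\<tau> n \<omega>, X (\<sigma> n \<omega>) \<omega>) - g (\<sigma> n \<omega>, X (\<sigma> n \<omega>) \<omega>) \<partial>M) \<longlonglongrightarrow> (\<integral>\<omega>. 0 \<partial>M)"
  proof (rule bounded_convergence[where C = "2 * C"])
    show "\<bar>g (\<tau> n \<omega>, X (\<sigma> n \<omega>) \<omega>) - g (\<sigma> n \<omega>, X (\<sigma> n \<omega>) \<omega>)\<bar> \<le> 2 * C" for n \<omega>
      using g_bound[of "(\<tau> n \<omega>, X (\<sigma> n \<omega>) \<omega>)"] g_bound[of "(\<sigma> n \<omega>, X (\<sigma> n \<omega>) \<omega>)"] by linarith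
    show "AE \<omega> in M. (\<lambda>n. g (\<tau> n \<omega>, X (\<sigma> n \<omega>) \<omega>) - g (\<sigma> n \<omega>, X (\<sigma> n \<omega>) \<omega>)) \<longlonglongrightarrow> 0"
    proof (rule AE_I2)
      fix \<omega> assume \<omega>: "\<omega> \<in> space M"
      obtain B where B: "\<And>t. t \<in> {0..T} \<Longrightarrow> \<bar>X t \<omega>\<bar> \<le> B"
        using cadlag_bounded[OF path_cadlag[OF \<omega>]] by blast
      have "uniformly_continuous_on ({0..T} \<times> {-B..B}) g"
        by (intro compact_uniformly_continuous continuous_on_subset[OF g_cont] compact_Times) auto
      note unif = this[unfolded uniformly_continuous_on_def, rule_format]
      show "(\<lambda>n. g (\<tau> n \<omega>, X (\<sigma> n \<omega>) \<omega>) - g (\<sigma> n \<omega>, X (\<sigma> n \<omega>) \<omega>)) \<longlonglongrightarrow> 0"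
      proof (rule tendstoI)
        fix e :: real assume "e > 0"
        then obtain d where d: "d > 0"
          "\<And>z z'. z \<in> {0..T} \<times> {-B..B} \<Longrightarrow> z' \<in> {0..T} \<times> {-B..B} \<Longrightarrow> dist z' z < d \<Longrightarrow> dist (g z') (g z) < e"
          using unif by metis
        have "\<forall>\<^sub>F n in sequentially. mesh (\<pi> n) < d" using mesh_0 d(1) by (rule order_tendstoD)
        then show "\<forall>\<^sub>F n in sequentially.
            dist (g (\<tau> n \<omega>, X (\<sigma> n \<omega>) \<omega>) - g (\<sigma> n \<omega>, X (\<sigma> n \<omega>) \<omega>)) 0 < e"
        proof eventually_elim
          case (elim n)
          note r = admissible_range(2)[OF \<tau> \<omega>, of n]
          have s: "\<sigma> n \<omega> \<in> {0..T}" using \<sigma>_in[OF \<omega>] points(2) by blast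
          have x: "X (\<sigma> n \<omega>) \<omega> \<in> {-B..B}" using B[OF s] by (auto simp: abs_le_iff)
          have "dist (\<tau> n \<omega>, X (\<sigma> n \<omega>) \<omega>) (\<sigma> n \<omega>, X (\<sigma> n \<omega>) \<omega>) < d"
            using last_point_close[OF subdivision T_pos r, of n] last_point_le(1)[OF subdivision r, of n] elim
            by (simp add: dist_Pair_Pair dist_real_def \<sigma>_def)
          then have "dist (g (\<tau> n \<omega>, X (\<sigma> n \<omega>) \<omega>)) (g (\<sigma> n \<omega>, X (\<sigma> n \<omega>) \<omega>)) < e"
            by (intro d(2)) (use r s x in auto)
          then show ?case by (simp add: dist_real_def)
        qed
      qed
    qed
  qed (use meas in auto)
  ultimately show ?thesis by (simp add: \<sigma>_def[abs_def])
qed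

abbreviation "\<Gamma>\<^sub>D n \<equiv> stopping_value M g (\<F>\<^sub>D n) (X\<^sub>D n) L"
abbreviation "\<Gamma> \<equiv> stopping_value M g \<F> X L"

lemma discretized_value_upper:
  assumes "e > 0" shows "\<forall>\<^sub>F n in sequentially. \<Gamma>\<^sub>D n < \<Gamma> + e"
proof -
  have "\<exists>\<tau>. admissible (\<F>\<^sub>D n) \<tau> \<and> \<Gamma>\<^sub>D n - e / 2 < payoff (X\<^sub>D n) \<tau>" for n
    using near_optimal_stopping_time[of "e / 2"] assms by (metis half_gt_zero)
  then obtain \<tau> where \<tau>: "\<And>n. admissible (\<F>\<^sub>D n) (\<tau> n)" "\<And>n. \<Gamma>\<^sub>D n - e / 2 < payoff (X\<^sub>D n) (\<tau> n)"
    by metis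
  have \<sigma>: "payoff X (\<lambda>\<omega>. last_point (\<pi> n) (\<tau> n \<omega>)) \<le> \<Gamma>" for n
    using last_point_admissible[OF \<tau>(1)[of n]]
    by (intro payoff_le_stopping_value) (auto simp: admissible_def intro: stopping_time_\<F>\<^sub>D_imp_\<F>)
  have "\<forall>\<^sub>F n in sequentially.
      payoff (X\<^sub>D n) (\<tau> n) - payoff X (\<lambda>\<omega>. last_point (\<pi> n) (\<tau> n \<omega>)) < e / 2"
    using rounding_error_vanishes[OF \<tau>(1)] by (rule order_tendstoD) (use assms in simp)
  then show ?thesis
  proof eventually_elim
    case (elim n)
    then show ?case using \<tau>(2)[of n] \<sigma>[of n] by simp
  qed
qed

section \<open>Lower bound for the discretised values\<close>

definition grid_entry :: "nat \<Rightarrow> (real \<Rightarrow> 'a set) \<Rightarrow> 'a \<Rightarrow> real" where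
  "grid_entry m = first_entry (\<pi> m \<inter> {..<L}) L"

lemma grid_entry_in: "grid_entry m A \<omega> \<in> insert L (\<pi> m \<inter> {..<L})"
  using first_entry_in[of "\<pi> m \<inter> {..<L}" L A \<omega>] points(1) by (auto simp: grid_entry_def)

lemma grid_range: "insert L (\<pi> m \<inter> {..<L}) \<subseteq> {0..L}" "insert L (\<pi> m \<inter> {..<L}) \<subseteq> {0..T}"
  using points(2)[of m] L_nonneg L_le_T by auto

lemma grid_entry_borel:
  assumes "\<And>r. r \<in> \<pi> m \<Longrightarrow> r < L \<Longrightarrow> A r \<in> sets M"
  shows "grid_entry m A \<in> borel_measurable M"
proof (rule stopping_time_borel_measurable[of "\<lambda>_. M"])
  show "stopping_time (\<lambda>_. M) (grid_entry m A)"
    unfolding grid_entry_def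
    by (rule first_entry_stopping_time[where \<Omega> = "space M"]) (use assms points(1) in auto)
qed auto

lemma grid_entry_payoff_borel:
  assumes "\<And>r. r \<in> \<pi> m \<Longrightarrow> r < L \<Longrightarrow> A r \<in> sets M"
  shows "(\<lambda>\<omega>. g (grid_entry m A \<omega>, X (grid_entry m A \<omega>) \<omega>)) \<in> borel_measurable M"
  by (rule payoff_borel[where I = "insert L (\<pi> m \<inter> {..<L})"])
    (use grid_entry_in grid_range grid_entry_borel[OF assms] points(1) in auto)

lemma stopping_time_less_in_\<F>\<^sub>X:
  assumes "admissible \<F> \<tau>" shows "{\<omega> \<in> space M. \<tau> \<omega> < r} \<in> sets (\<F>\<^sub>X r)"
  by (rule stopping_time_less_sets[of \<F>]) (use assms \<F>_le_\<F>\<^sub>X in \<open>auto simp: admissible_def\<close>)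

text \<open>
  Here the grid entry time is the first point of the $m$-th subdivision strictly after $\tau$,
  capped at $L$. It approaches $\tau$ from the right unless $\tau = L$, where it is constant, so
  right-continuity of the path applies. The approximation also shows that the payoff at $\tau$
  is measurable.
\<close>

lemma round_up_payoff_converges:
  assumes \<tau>: "admissible \<F> \<tau>"
  shows "(\<lambda>m. payoff X (grid_entry m (\<lambda>r. {\<omega> \<in> space M. \<tau> \<omega> < r}))) \<longlonglongrightarrow> payoff X \<tau>"
proof -
  define \<sigma> where "\<sigma> m = grid_entry m (\<lambda>r. {\<omega> \<in> space M. \<tau> \<omega> < r})" for m
  have meas: "(\<lambda>\<omega>. g (\<sigma> m \<omega>, X (\<sigma> m \<omega>) \<omega>)) \<in> borel_measurable M" for m
    unfolding \<sigma>_def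
    by (rule grid_entry_payoff_borel) (use stopping_time_less_in_\<F>\<^sub>X[OF \<tau>] \<F>\<^sub>X_le_M in blast)
  have conv: "(\<lambda>m. g (\<sigma> m \<omega>, X (\<sigma> m \<omega>) \<omega>)) \<longlonglongrightarrow> g (\<tau> \<omega>, X (\<tau> \<omega>) \<omega>)" if \<omega>: "\<omega> \<in> space M" for \<omega>
  proof (cases "\<tau> \<omega> < L")
    case False
    then have "\<tau> \<omega> = L" using admissible_range(1)[OF \<tau> \<omega>] by auto
    moreover have "\<sigma> m \<omega> = L" for m
      using first_entry_in[of "\<pi> m \<inter> {..<L}" L "\<lambda>r. {\<omega> \<in> space M. \<tau> \<omega> < r}" \<omega>] points(1) False
      by (auto simp: \<sigma>_def grid_entry_def)
    ultimately show ?thesis by simp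
  next
    case True
    have gt: "\<tau> \<omega> < \<sigma> m \<omega>" for m
      using first_entry_in[of "\<pi> m \<inter> {..<L}" L "\<lambda>r. {\<omega> \<in> space M. \<tau> \<omega> < r}" \<omega>] points(1) True
      by (auto simp: \<sigma>_def grid_entry_def)
    have le: "\<sigma> m \<omega> \<le> \<tau> \<omega> + mesh (\<pi> m)" for m
    proof -
      have "0 \<le> \<tau> \<omega>" "\<tau> \<omega> < T" using admissible_range(1)[OF \<tau> \<omega>] True L_le_T by auto
      then obtain d where d: "d \<in> \<pi> m" "\<tau> \<omega> < d" "d \<le> \<tau> \<omega> + mesh (\<pi> m)"
        using next_point[OF subdivision _ _ points(3)] by metis
      then have "\<sigma> m \<omega> \<le> d"
        using \<omega> points(1) by (auto simp: \<sigma>_def grid_entry_def first_entry_le_iff not_less)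
      then show ?thesis using d(3) by simp
    qed
    have lim: "(\<lambda>m. \<sigma> m \<omega>) \<longlonglongrightarrow> \<tau> \<omega>"
    proof (rule tendsto_sandwich[OF _ _ tendsto_const])
      show "(\<lambda>m. \<tau> \<omega> + mesh (\<pi> m)) \<longlonglongrightarrow> \<tau> \<omega>"
        using tendsto_add[OF tendsto_const mesh_0, of "\<tau> \<omega>"] by simp
    qed (use less_imp_le[OF gt] le in auto)
    have "\<tau> \<omega> \<in> {0..<T}" using admissible_range(1)[OF \<tau> \<omega>] True L_le_T by auto
    then have "((\<lambda>t. X t \<omega>) \<longlongrightarrow> X (\<tau> \<omega>) \<omega>) (at_right (\<tau> \<omega>))"
      using path_cadlag[OF \<omega>] unfolding cadlag_def by blast
    then have "(\<lambda>m. X (\<sigma> m \<omega>) \<omega>) \<longlonglongrightarrow> X (\<tau> \<omega>) \<omega>"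
      using tendsto_compose_within_insert[of "\<lambda>t. X t \<omega>" "\<tau> \<omega>" "{\<tau> \<omega><..}" "\<lambda>m. \<sigma> m \<omega>"] lim gt by auto
    then show ?thesis
      using lim by (intro continuous_on_tendsto_compose[OF g_cont] tendsto_Pair) auto
  qed
  have "(\<lambda>\<omega>. g (\<tau> \<omega>, X (\<tau> \<omega>) \<omega>)) \<in> borel_measurable M"
    by (rule borel_measurable_LIMSEQ_real[OF conv meas])
  then show ?thesis
    unfolding payoff_def \<sigma>_def[symmetric]
    by (intro bounded_convergence[where C = C] meas AE_I2 conv g_bound) 
qed

text \<open>
  The time takes finitely many values, so almost surely the discretised process converges at all
  of them simultaneously.
\<close>

lemma fixed_grid_payoff_converges:
  assumes A: "\<And>r. r \<in> \<pi> m \<Longrightarrow> r < L \<Longrightarrow> A r \<in> sets M"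
  shows "(\<lambda>n. payoff (X\<^sub>D n) (grid_entry m A)) \<longlonglongrightarrow> payoff X (grid_entry m A)"
  unfolding payoff_def
proof (rule bounded_convergence[where C = C])
  let ?I = "insert L (\<pi> m \<inter> {..<L})"
  have fin: "finite ?I" using points(1) by simp
  show "(\<lambda>\<omega>. g (grid_entry m A \<omega>, X\<^sub>D n (grid_entry m A \<omega>) \<omega>)) \<in> borel_measurable M" for n
  proof (rule borel_measurable_continuous_pair[OF g_cont grid_entry_borel[OF A]])
    show "(\<lambda>\<omega>. X\<^sub>D n (grid_entry m A \<omega>) \<omega>) \<in> borel_measurable M"
    proof (rule borel_measurable_at_finite_valued_time[OF fin grid_entry_borel[OF A] grid_entry_in])
      fix r assume "r \<in> ?I"
      then have r: "r \<in> {0..T}" using grid_range(2) by blast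
      have "last_point (\<pi> n) r \<in> {0..T}"
        using last_point_le(2)[OF subdivision r] points(2) by blast
      then have "X (last_point (\<pi> n) r) \<in> borel_measurable M" by (rule X_measurable)
      moreover have "X\<^sub>D n r = X (last_point (\<pi> n) r)"
        by (rule ext) (rule discretization_eq_last_point[OF subdivision r])
      ultimately show "X\<^sub>D n r \<in> borel_measurable M" by simp
    qed
  qed
  have "AE \<omega> in M. \<forall>r\<in>?I. (\<lambda>n. X\<^sub>D n r \<omega>) \<longlonglongrightarrow> X r \<omega>"
    using grid_range(2)[of m] by (intro AE_finite_allI[OF fin] fixed_time_convergence) blast
  then show "AE \<omega> in M. (\<lambda>n. g (grid_entry m A \<omega>, X\<^sub>D n (grid_entry m A \<omega>) \<omega>))
      \<longlonglongrightarrow> g (grid_entry m A \<omega>, X (grid_entry m A \<omega>) \<omega>)"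
  proof (rule AE_mp, intro AE_I2 impI)
    fix \<omega> assume "\<forall>r\<in>?I. (\<lambda>n. X\<^sub>D n r \<omega>) \<longlonglongrightarrow> X r \<omega>"
    then have "(\<lambda>n. X\<^sub>D n (grid_entry m A \<omega>) \<omega>) \<longlonglongrightarrow> X (grid_entry m A \<omega>) \<omega>"
      using grid_entry_in by blast
    then show "(\<lambda>n. g (grid_entry m A \<omega>, X\<^sub>D n (grid_entry m A \<omega>) \<omega>))
      \<longlonglongrightarrow> g (grid_entry m A \<omega>, X (grid_entry m A \<omega>) \<omega>)"
      by (intro continuous_on_tendsto_compose[OF g_cont] tendsto_Pair tendsto_const) auto
  qed
qed (use grid_entry_payoff_borel[OF A] g_bound in auto)

text \<open>
  A near-optimal $\tau$ is rounded up to a fixed grid, then its events $\{\tau < r\}$ are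
  replaced by events seen by a discretised filtration. Each of these two steps, the choice of
  $\tau$ and the final passage from $X$ to the discretised process costs at most $e/4$.
\<close>

lemma discretized_value_lower:
  assumes e: "e > 0" shows "\<forall>\<^sub>F n in sequentially. \<Gamma> - e < \<Gamma>\<^sub>D n"
proof -
  obtain \<tau> where \<tau>: "admissible \<F> \<tau>" "\<Gamma> - e / 4 < payoff X \<tau>"
    using near_optimal_stopping_time[of "e / 4"] e by (metis zero_less_divide_iff zero_less_numeral)
  define A where "A r = {\<omega> \<in> space M. \<tau> \<omega> < r}" for r
  have "\<forall>\<^sub>F m in sequentially. payoff X \<tau> - e / 4 < payoff X (grid_entry m A)"
    unfolding A_def[abs_def]
    using round_up_payoff_converges[OF \<tau>(1)] by (rule order_tendstoD) (use e in simp)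
  then obtain m where m: "payoff X \<tau> - e / 4 < payoff X (grid_entry m A)"
    by (auto dest: eventually_happens)
  define Q where "Q = \<pi> m \<inter> {..<L}"
  have finQ: "finite Q" using points(1) by (simp add: Q_def)
  have AM: "A r \<in> sets M" for r
    using stopping_time_less_in_\<F>\<^sub>X[OF \<tau>(1), of r] \<F>\<^sub>X_le_M[of r] by (auto simp: A_def)
  \<comment> \<open>Replacing the events at each of the \<open>card Q\<close> grid points changes the payoff by at most
    $2C$ times the probability of the replacement error. Adding $1$ to both factors avoids division by $0$.\<close>
  define d where "d = e / (4 * ((2 * C + 1) * (real (card Q) + 1)))"
  have "d > 0" using e C_nonneg by (auto simp: d_def intro!: divide_pos_pos mult_pos_pos)
  have "\<exists>n. \<exists>B\<in>sets (\<F>\<^sub>D n r). measure M ((A r - B) \<union> (B - A r)) < d" if r: "r \<in> Q" for r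
  proof (rule approximation_by_increasing_union)
    have "r \<in> \<pi> m" using r by (simp add: Q_def)
    then show "A r \<in> sigma_sets (space M) (\<Union>n. sets (\<F>\<^sub>D n r))"
      using stopping_time_less_in_\<F>\<^sub>X[OF \<tau>(1), of r] \<F>\<^sub>X_le_sigma_\<F>\<^sub>D by (auto simp: A_def)
  qed (use \<F>\<^sub>D_mono \<F>\<^sub>D_le_M \<open>d > 0\<close> in auto)
  then obtain N B where B: "\<And>r. r \<in> Q \<Longrightarrow> B r \<in> sets (\<F>\<^sub>D (N r) r)"
    "\<And>r. r \<in> Q \<Longrightarrow> measure M ((A r - B r) \<union> (B r - A r)) < d" by metis
  have BM: "B r \<in> sets M" if "r \<in> Q" for r using B(1)[OF that] \<F>\<^sub>D_le_M by blast
  have BM': "B r \<in> sets M" if "r \<in> \<pi> m" "r < L" for r using BM that by (simp add: Q_def)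
  let ?D = "\<lambda>r. (A r - B r) \<union> (B r - A r)"
  have "\<bar>payoff X (grid_entry m A) - payoff X (grid_entry m B)\<bar> \<le> 2 * C * measure M (\<Union>r\<in>Q. ?D r)"
    unfolding payoff_def
  proof (rule integral_differ_on_set)
    show "(\<Union>r\<in>Q. ?D r) \<in> sets M" using finQ AM BM by (intro sets.finite_UN) auto
    fix \<omega> assume "\<omega> \<notin> (\<Union>r\<in>Q. ?D r)"
    then have "{r \<in> Q. \<omega> \<in> A r} = {r \<in> Q. \<omega> \<in> B r}" by auto
    then have "grid_entry m A \<omega> = grid_entry m B \<omega>"
      by (simp only: grid_entry_def first_entry_def Q_def)
    then show "g (grid_entry m A \<omega>, X (grid_entry m A \<omega>) \<omega>) = g (grid_entry m B \<omega>, X (grid_entry m B \<omega>) \<omega>)"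
      by simp
  qed (use grid_entry_payoff_borel AM BM' g_bound in auto)
  also have "measure M (\<Union>r\<in>Q. ?D r) \<le> (\<Sum>r\<in>Q. measure M (?D r))"
    using finQ AM BM by (intro measure_UNION_le) auto
  also have "\<dots> \<le> (\<Sum>r\<in>Q. d)" using B(2) by (intro sum_mono less_imp_le)
  also have "(\<Sum>r\<in>Q. d) = real (card Q) * d" by simp
  also have "2 * C * (real (card Q) * d) \<le> (2 * C + 1) * ((real (card Q) + 1) * d)"
    using C_nonneg \<open>d > 0\<close> by (intro mult_mono) auto
  also have "\<dots> = e / 4"
  proof -
    have "(2 * C + 1) * (real (card Q) + 1) \<noteq> 0"
      using C_nonneg by (intro mult_pos_pos[THEN less_imp_neq, symmetric]) auto
    then have "x * d = e / 4" if "x = (2 * C + 1) * (real (card Q) + 1)" for x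
      using that by (simp add: d_def)
    from this[OF refl] show ?thesis by (simp only: mult.assoc)
  qed
  finally have AB: "\<bar>payoff X (grid_entry m A) - payoff X (grid_entry m B)\<bar> \<le> e / 4"
    using C_nonneg by (simp add: mult_left_mono)
  \<comment> \<open>From stage \<open>N0\<close> on, all the approximating events are observed at their respective
    times.\<close>
  define N0 where "N0 = Max (insert 0 (N ` Q))"
  have adm: "admissible (\<F>\<^sub>D n) (grid_entry m B)" if n: "n \<ge> N0" for n
    unfolding admissible_def
  proof (intro conjI ballI)
    show "stopping_time (\<F>\<^sub>D n) (grid_entry m B)"
      unfolding grid_entry_def Q_def[symmetric]
    proof (rule first_entry_stopping_time[where \<Omega> = "space M"])
      fix r t assume r: "r \<in> Q" "r \<le> t"
      have "N r \<le> N0" using r(1) finQ by (auto simp: N0_def)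
      then show "B r \<in> sets (\<F>\<^sub>D n t)" using B(1)[OF r(1)] \<F>\<^sub>D_mono[of "N r" n r t] n r(2) by auto
    qed (use finQ in auto)
    show "grid_entry m B \<omega> \<in> {0..L}" for \<omega>
      using grid_entry_in[of m B \<omega>] grid_range(1)[of m] by blast
  qed
  have "\<forall>\<^sub>F n in sequentially. payoff X (grid_entry m B) - e / 4 < payoff (X\<^sub>D n) (grid_entry m B)"
    using e by (intro order_tendstoD(1)[OF fixed_grid_payoff_converges[OF BM']]) linarith+
  with eventually_ge_at_top[of N0] show ?thesis
  proof eventually_elim
    case (elim n)
    have "payoff (X\<^sub>D n) (grid_entry m B) \<le> \<Gamma>\<^sub>D n"
      by (rule payoff_le_stopping_value[OF adm[OF elim(1)]])
    then show ?case using elim(2) AB m \<tau>(2) by linarith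
  qed
qed

section \<open>Convergence of the values\<close>

theorem discretized_value_converges: "\<Gamma>\<^sub>D \<longlonglongrightarrow> \<Gamma>"
proof (rule order_tendstoI)
  show "\<forall>\<^sub>F n in sequentially. a < \<Gamma>\<^sub>D n" if "a < \<Gamma>" for a
    using discretized_value_lower[of "\<Gamma> - a"] that by simp
  show "\<forall>\<^sub>F n in sequentially. \<Gamma>\<^sub>D n < a" if "\<Gamma> < a" for a
    using discretized_value_upper[of "a - \<Gamma>"] that by simp
qed

end

lemma stopping_value_cong_reward:
  assumes "\<And>t x. t \<ge> 0 \<Longrightarrow> g (t, x) = h (t, x)"
  shows "stopping_value M g F Y L = stopping_value M h F Y L"
  unfolding stopping_value_def using assms
  by (intro SUP_cong refl Bochner_Integration.integral_cong) auto

theorem proposition26: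
  fixes M :: "'a measure" and T L :: real
    and \<gamma> :: "real \<times> real \<Rightarrow> real"
    and X :: "real \<Rightarrow> 'a \<Rightarrow> real"
    and \<pi> :: "nat \<Rightarrow> real set"
  assumes "prob_space M"
    and "T > 0" and "L \<in> {0..T}"
    and "continuous_on ({0..} \<times> UNIV) \<gamma>" and "bounded (\<gamma> ` ({0..} \<times> UNIV))"
    and "cadlag_process M T X"
    and "\<And>t. t \<in> {0..T} \<Longrightarrow> measure M {\<omega> \<in> space M. jump X t \<omega> \<noteq> 0} = 0"
    and "\<And>n. subdivision T (\<pi> n)"
    and "incseq \<pi>"
    and "(\<lambda>n. mesh (\<pi> n)) \<longlonglongrightarrow> 0"
  shows "(\<lambda>n. stopping_value M \<gamma>
            (natural_filtration M T (discretization T (\<pi> n) X)) (discretization T (\<pi> n) X) L)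
         \<longlonglongrightarrow> stopping_value M \<gamma> (right_limit_filtration (natural_filtration M T X)) X L"
proof -
  \<comment> \<open>The reward is controlled at nonnegative times only, and stopping times take no other
    values.\<close>
  define g where "g z = \<gamma> (max 0 (fst z), snd z)" for z
  obtain C where C: "\<And>z. z \<in> {0..} \<times> UNIV \<Longrightarrow> \<bar>\<gamma> z\<bar> \<le> C"
    using assms(5) unfolding bounded_iff by (metis image_eqI real_norm_def)
  interpret prob_space M by fact
  interpret discretized_stopping_problem M T X \<pi> g C L
  proof
    show "\<bar>g z\<bar> \<le> C" for z unfolding g_def by (rule C) auto
    show "continuous_on UNIV g" unfolding g_def[abs_def]
      by (rule continuous_on_compose2[OF assms(4)]) (auto intro!: continuous_intros)
  qed (use assms in auto)
  have "stopping_value M \<gamma> F Y L = stopping_value M g F Y L" for F Y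
    by (rule stopping_value_cong_reward) (simp add: g_def)
  then show ?thesis using discretized_value_converges by simp
qed

end
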